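(* Let $(\varGamma,C)$ be a split-step SUSYQW (the coin need not be anisotropic). Define the operator on $\ell^2(\mathbb Z)\oplus\ell^2(\mathbb Z)$ \[ \epsilon=\frac{1}{\sqrt2}\begin{pmatrix}\sqrt{1+p} & -\sqrt{1-p}\\ \sqrt{1-p}\,e^{-i\theta}L^* & \sqrt{1+p}\,e^{-i\theta}L^*\end{pmatrix} \] and operators $Q_{\epsilon_\pm}$ on $\ell^2(\mathbb Z)$ by \[ -2iQ_{\epsilon_\pm}=(1\pm p)e^{i\theta}Lb-(1\mp p)e^{-i\theta}\,\overline{b}\,L^*\pm|q|\big(a_2(\cdot+1)-a_1\big), \] where products denote composition with the multiplication operators by $b$, $\overline b$, and by the sequences $a_2(\cdot+1)=(a_2(x+1))_{x}$ and $a_1$. Then $\epsilon$ is unitary and \[ \epsilon^*Q\epsilon=\begin{pmatrix}0 & Q_{\epsilon_-}\\ Q_{\epsilon_+} & 0\end{pmatrix} \] with respect to $\mathcal H=\ell^2(\mathbb Z)\oplus\ell^2(\mathbb Z)$. Moreover, $(\varGamma,C)$ is Fredholm if and only if $Q_{\epsilon_+}$ is a Fredholm operator, and in that case \[ \operatorname{ind}(\varGamma,C)=\operatorname{ind}Q_{\epsilon_+}=\dim\ker Q_{\epsilon_+}-\dim\ker Q_{\epsilon_-}. \]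
   Context: Let $\mathcal H=\ell^2(\mathbb Z,\mathbb C^2)\cong\ell^2(\mathbb Z)\oplus\ell^2(\mathbb Z)$, $L$ the left shift $(L\Psi)(x)=\Psi(x+1)$ on $\ell^2(\mathbb Z)$. A split-step SUSYQW is the pair $\varGamma=\begin{pmatrix} p & qL\\ \overline{q}L^* & -p\end{pmatrix}$, $C=\begin{pmatrix} a_1 & \overline{b}\\ b & a_2\end{pmatrix}$ with $p\in\mathbb R$, $q\in\mathbb C\setminus\{0\}$, $p^2+|q|^2=1$, $\theta=\operatorname{Arg}q$, real sequences $a_1,a_2$ and complex sequence $b$ on $\mathbb Z$ (as multiplication operators) with $a_j(x)^2+|b(x)|^2=1$ and $b(x)(a_1(x)+a_2(x))=0$ for all $x$. $Q=[\varGamma,C]/(2i)$, $H=Q^2$, $\mathcal H_\pm=\ker(\varGamma\mp1)$, $Q_+=Q|_{\mathcal H_+}:\mathcal H_+\to\mathcal H_-$, $H_\pm=H|_{\mathcal H_\pm}$. $(\varGamma,C)$ is Fredholm if $Q_+$ is Fredholm; $\operatorname{ind}(\varGamma,C)=\dim\ker H_+-\dim\ker H_-$. *)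

theory Defs
  imports "HOL-Analysis.Analysis" "HOL-Library.Function_Algebras"
begin

text \<open>A space is given by a carrier set of vectors, a complex scalar multiplication
  and a (sesquilinear) inner product; operators are functions on the ambient type,
  restricted to the carrier.\<close>

definition ker_on :: "'v set \<Rightarrow> ('v \<Rightarrow> 'w::zero) \<Rightarrow> 'v set" where
  "ker_on X T = {u \<in> X. T u = 0}"

definition orth_on :: "('w \<Rightarrow> 'w \<Rightarrow> complex) \<Rightarrow> 'w set \<Rightarrow> 'w set \<Rightarrow> 'w set" where
  "orth_on ip Y S = {v \<in> Y. \<forall>u\<in>S. ip u v = 0}"

definition ip_norm :: "('v \<Rightarrow> 'v \<Rightarrow> complex) \<Rightarrow> 'v \<Rightarrow> real" where
  "ip_norm ip u = sqrt (Re (ip u u))"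

definition norm_closed_in :: "('v::ab_group_add \<Rightarrow> 'v \<Rightarrow> complex) \<Rightarrow> 'v set \<Rightarrow> 'v set \<Rightarrow> bool" where
  "norm_closed_in ip Y S \<longleftrightarrow>
     (\<forall>s y. (\<forall>n. s n \<in> S) \<and> y \<in> Y \<and> (\<lambda>n. ip_norm ip (s n - y)) \<longlonglongrightarrow> 0 \<longrightarrow> y \<in> S)"

definition bounded_linear_on ::
  "(complex \<Rightarrow> 'v \<Rightarrow> 'v) \<Rightarrow> (complex \<Rightarrow> 'w \<Rightarrow> 'w) \<Rightarrow> ('v \<Rightarrow> 'v \<Rightarrow> complex) \<Rightarrow> ('w \<Rightarrow> 'w \<Rightarrow> complex)
    \<Rightarrow> 'v::ab_group_add set \<Rightarrow> 'w::ab_group_add set \<Rightarrow> ('v \<Rightarrow> 'w) \<Rightarrow> bool" where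
  "bounded_linear_on scX scY ipX ipY X Y T \<longleftrightarrow>
     (\<forall>u\<in>X. T u \<in> Y) \<and>
     (\<forall>u\<in>X. \<forall>v\<in>X. T (u + v) = T u + T v) \<and>
     (\<forall>c. \<forall>u\<in>X. T (scX c u) = scY c (T u)) \<and>
     (\<exists>K. \<forall>u\<in>X. ip_norm ipY (T u) \<le> K * ip_norm ipX u)"

definition fin_dim :: "(complex \<Rightarrow> 'v \<Rightarrow> 'v) \<Rightarrow> 'v::ab_group_add set \<Rightarrow> bool" where
  "fin_dim sc S \<longleftrightarrow> (\<exists>B. finite B \<and> B \<subseteq> S \<and> module.span sc B = S)"

definition cdim :: "(complex \<Rightarrow> 'v \<Rightarrow> 'v) \<Rightarrow> 'v::ab_group_add set \<Rightarrow> nat" where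
  "cdim sc S = vector_space.dim sc S"

text \<open>Fredholm operator T : X \<rightarrow> Y between (closed subspaces of) Hilbert spaces:
  bounded linear, finite-dimensional kernel, closed range, finite-dimensional cokernel
  (cokernel realised as the orthogonal complement of the range in Y).\<close>
definition fredholm_on ::
  "(complex \<Rightarrow> 'v \<Rightarrow> 'v) \<Rightarrow> (complex \<Rightarrow> 'w \<Rightarrow> 'w) \<Rightarrow> ('v \<Rightarrow> 'v \<Rightarrow> complex) \<Rightarrow> ('w \<Rightarrow> 'w \<Rightarrow> complex)
    \<Rightarrow> 'v::ab_group_add set \<Rightarrow> 'w::ab_group_add set \<Rightarrow> ('v \<Rightarrow> 'w) \<Rightarrow> bool" where
  "fredholm_on scX scY ipX ipY X Y T \<longleftrightarrow>
     bounded_linear_on scX scY ipX ipY X Y T \<and>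
     fin_dim scX (ker_on X T) \<and>
     norm_closed_in ipY Y (T ` X) \<and>
     fin_dim scY (orth_on ipY Y (T ` X))"

definition fred_index ::
  "(complex \<Rightarrow> 'v \<Rightarrow> 'v) \<Rightarrow> (complex \<Rightarrow> 'w \<Rightarrow> 'w) \<Rightarrow> ('w \<Rightarrow> 'w \<Rightarrow> complex)
    \<Rightarrow> 'v::ab_group_add set \<Rightarrow> 'w::ab_group_add set \<Rightarrow> ('v \<Rightarrow> 'w) \<Rightarrow> int" where
  "fred_index scX scY ipY X Y T =
     int (cdim scX (ker_on X T)) - int (cdim scY (orth_on ipY Y (T ` X)))"

definition unitary_on :: "('v \<Rightarrow> 'v \<Rightarrow> complex) \<Rightarrow> 'v set \<Rightarrow> ('v \<Rightarrow> 'v) \<Rightarrow> bool" where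
  "unitary_on ip X U \<longleftrightarrow> bij_betw U X X \<and> (\<forall>u\<in>X. \<forall>v\<in>X. ip (U u) (U v) = ip u v)"

definition adjoint_on :: "('v \<Rightarrow> 'v \<Rightarrow> complex) \<Rightarrow> 'v set \<Rightarrow> ('v \<Rightarrow> 'v) \<Rightarrow> 'v \<Rightarrow> 'v" where
  "adjoint_on ip X T v = (THE w. w \<in> X \<and> (\<forall>u\<in>X. ip (T u) v = ip u w))"

type_synonym seq = "int \<Rightarrow> complex"
type_synonym seq2 = "seq \<times> seq"

definition l2 :: "seq set" where
  "l2 = {f. (\<lambda>x. (cmod (f x))\<^sup>2) summable_on UNIV}"

definition ip1 :: "seq \<Rightarrow> seq \<Rightarrow> complex" where
  "ip1 f g = (\<Sum>\<^sub>\<infinity>x. f x * cnj (g x))"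

definition sc1 :: "complex \<Rightarrow> seq \<Rightarrow> seq" where
  "sc1 c f = (\<lambda>x. c * f x)"

definition H2 :: "seq2 set" where
  "H2 = l2 \<times> l2"

definition ip2 :: "seq2 \<Rightarrow> seq2 \<Rightarrow> complex" where
  "ip2 u v = ip1 (fst u) (fst v) + ip1 (snd u) (snd v)"

definition sc2 :: "complex \<Rightarrow> seq2 \<Rightarrow> seq2" where
  "sc2 c u = (sc1 c (fst u), sc1 c (snd u))"

definition Lsh :: "seq \<Rightarrow> seq" where "Lsh f = (\<lambda>x. f (x + 1))"
definition Lsh_adj :: "seq \<Rightarrow> seq" where "Lsh_adj f = (\<lambda>x. f (x - 1))"

definition susyqw :: "real \<Rightarrow> complex \<Rightarrow> (int \<Rightarrow> real) \<Rightarrow> (int \<Rightarrow> real) \<Rightarrow> (int \<Rightarrow> complex) \<Rightarrow> bool" where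
  "susyqw p q a1 a2 b \<longleftrightarrow> q \<noteq> 0 \<and> p\<^sup>2 + (cmod q)\<^sup>2 = 1 \<and>
     (\<forall>x. (a1 x)\<^sup>2 + (cmod (b x))\<^sup>2 = 1) \<and> (\<forall>x. (a2 x)\<^sup>2 + (cmod (b x))\<^sup>2 = 1) \<and>
     (\<forall>x. b x * complex_of_real (a1 x + a2 x) = 0)"

definition Gam :: "real \<Rightarrow> complex \<Rightarrow> seq2 \<Rightarrow> seq2" where
  "Gam p q u = ((\<lambda>x. p * fst u x + q * Lsh (snd u) x),
               (\<lambda>x. cnj q * Lsh_adj (fst u) x - p * snd u x))"

definition Coin :: "(int \<Rightarrow> real) \<Rightarrow> (int \<Rightarrow> real) \<Rightarrow> (int \<Rightarrow> complex) \<Rightarrow> seq2 \<Rightarrow> seq2" where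
  "Coin a1 a2 b u = ((\<lambda>x. a1 x * fst u x + cnj (b x) * snd u x),
                    (\<lambda>x. b x * fst u x + a2 x * snd u x))"

definition Qop :: "real \<Rightarrow> complex \<Rightarrow> (int \<Rightarrow> real) \<Rightarrow> (int \<Rightarrow> real) \<Rightarrow> (int \<Rightarrow> complex) \<Rightarrow> seq2 \<Rightarrow> seq2" where
  "Qop p q a1 a2 b u = sc2 (1 / (2 * \<i>)) (Gam p q (Coin a1 a2 b u) - Coin a1 a2 b (Gam p q u))"

definition Hop :: "real \<Rightarrow> complex \<Rightarrow> (int \<Rightarrow> real) \<Rightarrow> (int \<Rightarrow> real) \<Rightarrow> (int \<Rightarrow> complex) \<Rightarrow> seq2 \<Rightarrow> seq2" where
  "Hop p q a1 a2 b u = Qop p q a1 a2 b (Qop p q a1 a2 b u)"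

definition Hplus :: "real \<Rightarrow> complex \<Rightarrow> seq2 set" where
  "Hplus p q = {u \<in> H2. Gam p q u = u}"

definition Hminus :: "real \<Rightarrow> complex \<Rightarrow> seq2 set" where
  "Hminus p q = {u \<in> H2. Gam p q u = - u}"

definition susy_fredholm :: "real \<Rightarrow> complex \<Rightarrow> (int \<Rightarrow> real) \<Rightarrow> (int \<Rightarrow> real) \<Rightarrow> (int \<Rightarrow> complex) \<Rightarrow> bool" where
  "susy_fredholm p q a1 a2 b \<longleftrightarrow>
     fredholm_on sc2 sc2 ip2 ip2 (Hplus p q) (Hminus p q) (Qop p q a1 a2 b)"

definition susy_index :: "real \<Rightarrow> complex \<Rightarrow> (int \<Rightarrow> real) \<Rightarrow> (int \<Rightarrow> real) \<Rightarrow> (int \<Rightarrow> complex) \<Rightarrow> int" where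
  "susy_index p q a1 a2 b =
     int (cdim sc2 (ker_on (Hplus p q) (Hop p q a1 a2 b)))
     - int (cdim sc2 (ker_on (Hminus p q) (Hop p q a1 a2 b)))"

definition eps :: "real \<Rightarrow> complex \<Rightarrow> seq2 \<Rightarrow> seq2" where
  "eps p q u =
     ((\<lambda>x. (complex_of_real (sqrt (1 + p)) * fst u x - complex_of_real (sqrt (1 - p)) * snd u x)
              / complex_of_real (sqrt 2)),
      (\<lambda>x. (complex_of_real (sqrt (1 - p)) * (exp (- \<i> * complex_of_real (Arg q)) * Lsh_adj (fst u) x)
            + complex_of_real (sqrt (1 + p)) * (exp (- \<i> * complex_of_real (Arg q)) * Lsh_adj (snd u) x))
              / complex_of_real (sqrt 2)))"

text \<open>Q_{\<epsilon>\<pm>}, with s = 1 for + and s = -1 for -, defined through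
  -2i Q_{\<epsilon>\<pm>} = (1\<pm>p) e^{i\<theta>} L b - (1\<mp>p) e^{-i\<theta>} conj(b) L* \<pm> |q| (a_2(.+1) - a_1).\<close>
definition Qeps :: "real \<Rightarrow> real \<Rightarrow> complex \<Rightarrow> (int \<Rightarrow> real) \<Rightarrow> (int \<Rightarrow> real) \<Rightarrow> (int \<Rightarrow> complex) \<Rightarrow> seq \<Rightarrow> seq" where
  "Qeps s p q a1 a2 b f = (\<lambda>x.
     ((1 + s * p) * exp (\<i> * Arg q) * Lsh (\<lambda>y. b y * f y) x
      - (1 - s * p) * exp (- \<i> * Arg q) * (cnj (b x) * Lsh_adj f x)
      + complex_of_real (s * cmod q) * (complex_of_real (a2 (x + 1) - a1 x) * f x)) / (- 2 * \<i>))"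

end

theory Submission
  imports Defs
begin

text \<open>The unitary \<open>\<epsilon>\<close> diagonalises \<open>\<Gamma>\<close>: it maps the first summand of
  \<open>\<ell>\<^sup>2 \<oplus> \<ell>\<^sup>2\<close> onto \<open>\<H>\<^sub>+\<close> and the second onto \<open>\<H>\<^sub>-\<close>, so \<open>\<epsilon>\<^sup>*\<Gamma>\<epsilon> = 1 \<oplus> (-1)\<close>.
  In the commutator of \<open>1 \<oplus> (-1)\<close> with the block matrix \<open>\<epsilon>\<^sup>*C\<epsilon>\<close> only the off-diagonal blocks
  survive; up to factors \<open>\<plusminus>\<i>\<close> they are \<open>Q\<^sub>\<epsilon>\<^sub>+\<close> and \<open>Q\<^sub>\<epsilon>\<^sub>-\<close>. Hence \<open>Q\<^sub>+\<close> is unitarily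
  equivalent to \<open>Q\<^sub>\<epsilon>\<^sub>+\<close>, which transfers the Fredholm property, and so is \<open>H\<^sub>\<plusminus>\<close> to
  \<open>Q\<^sub>\<epsilon>\<^sub>\<minusplus> Q\<^sub>\<epsilon>\<^sub>\<plusminus>\<close>. Since \<open>Q\<^sub>\<epsilon>\<^sub>-\<close> is the adjoint of \<open>Q\<^sub>\<epsilon>\<^sub>+\<close>, the kernels of these products are
  the kernels of the right-hand factors, and the cokernel of \<open>Q\<^sub>\<epsilon>\<^sub>+\<close> is the kernel of \<open>Q\<^sub>\<epsilon>\<^sub>-\<close>.\<close>

section \<open>Adjoint operators on a complex inner product space\<close>

locale inner_product_space = vector_space scale
  for scale :: "complex \<Rightarrow> 'v::ab_group_add \<Rightarrow> 'v" +
  fixes ip :: "'v \<Rightarrow> 'v \<Rightarrow> complex" and X :: "'v set"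
  assumes subspace_carrier: "subspace X"
    and ip_commute: "u \<in> X \<Longrightarrow> v \<in> X \<Longrightarrow> ip v u = cnj (ip u v)"
    and ip_add_left: "u \<in> X \<Longrightarrow> v \<in> X \<Longrightarrow> w \<in> X \<Longrightarrow> ip (u + v) w = ip u w + ip v w"
    and ip_scale_left: "u \<in> X \<Longrightarrow> v \<in> X \<Longrightarrow> ip (scale c u) v = c * ip u v"
    and ip_pos_def: "u \<in> X \<Longrightarrow> u \<noteq> 0 \<Longrightarrow> 0 < Re (ip u u)"
begin

lemmas carrier_closed = subspace_0[OF subspace_carrier] subspace_add[OF subspace_carrier]
  subspace_diff[OF subspace_carrier] subspace_scale[OF subspace_carrier]

lemma ip_add_right:
  assumes "u \<in> X" "v \<in> X" "w \<in> X"
  shows "ip w (u + v) = ip w u + ip w v"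
  using assms by (simp add: ip_commute[of _ w] ip_add_left carrier_closed)

lemma ip_scale_right:
  assumes "u \<in> X" "v \<in> X"
  shows "ip v (scale c u) = cnj c * ip v u"
  using assms by (simp add: ip_commute[of _ v] ip_scale_left carrier_closed)

lemma ip_zero_left: "u \<in> X \<Longrightarrow> ip 0 u = 0"
  using ip_scale_left[of 0 u 0] by (simp add: carrier_closed)

lemma ip_zero_right: "u \<in> X \<Longrightarrow> ip u 0 = 0"
  using ip_scale_right[of 0 u 0] by (simp add: carrier_closed)

lemma ip_diff_left:
  assumes "u \<in> X" "v \<in> X" "w \<in> X"
  shows "ip (u - v) w = ip u w - ip v w"
  using ip_add_left[of "u - v" v w] assms by (simp add: carrier_closed)

lemma ip_diff_right:
  assumes "u \<in> X" "v \<in> X" "w \<in> X"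
  shows "ip w (u - v) = ip w u - ip w v"
  using ip_add_right[of "u - v" v w] assms by (simp add: carrier_closed)

lemma ip_self_nonneg: "u \<in> X \<Longrightarrow> 0 \<le> Re (ip u u)"
  using ip_pos_def[of u] ip_zero_left[of 0] by (cases "u = 0") (auto simp: carrier_closed)

lemma ip_self_eq_0_iff: "u \<in> X \<Longrightarrow> ip u u = 0 \<longleftrightarrow> u = 0"
  using ip_pos_def[of u] ip_zero_left[of u] by fastforce

lemma ip_left_eqI:
  assumes "v \<in> X" "w \<in> X" and eq: "\<And>u. u \<in> X \<Longrightarrow> ip u v = ip u w"
  shows "v = w"
proof -
  have "ip (v - w) (v - w) = 0"
    using assms by (simp add: ip_diff_right eq carrier_closed)
  then show ?thesis
    using assms by (simp add: ip_self_eq_0_iff carrier_closed)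
qed

lemma adjoint_on_eqI:
  assumes "w \<in> X" "\<And>u. u \<in> X \<Longrightarrow> ip (T u) v = ip u w"
  shows "adjoint_on ip X T v = w"
  unfolding adjoint_on_def using assms by (intro the_equality ip_left_eqI) auto

definition adjoint_pair :: "('v \<Rightarrow> 'v) \<Rightarrow> ('v \<Rightarrow> 'v) \<Rightarrow> bool" where
  "adjoint_pair T S \<longleftrightarrow> T \<in> X \<rightarrow> X \<and> S \<in> X \<rightarrow> X \<and> (\<forall>u\<in>X. \<forall>v\<in>X. ip (T u) v = ip u (S v))"

lemma adjoint_pairD:
  assumes "adjoint_pair T S"
  shows "u \<in> X \<Longrightarrow> T u \<in> X" "u \<in> X \<Longrightarrow> S u \<in> X"
    "u \<in> X \<Longrightarrow> v \<in> X \<Longrightarrow> ip (T u) v = ip u (S v)"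
  using assms by (auto simp: adjoint_pair_def)

lemma adjoint_pair_sym:
  assumes "adjoint_pair T S"
  shows "adjoint_pair S T"
  unfolding adjoint_pair_def
proof (intro conjI ballI)
  fix u v assume "u \<in> X" "v \<in> X"
  then show "ip (S u) v = ip u (T v)"
    using adjoint_pairD[OF assms] by (metis ip_commute)
qed (use adjoint_pairD[OF assms] in auto)

lemma adjoint_pair_add:
  "adjoint_pair T S \<Longrightarrow> adjoint_pair T' S' \<Longrightarrow> adjoint_pair (\<lambda>u. T u + T' u) (\<lambda>u. S u + S' u)"
  by (auto simp: adjoint_pair_def Pi_iff ip_add_left ip_add_right carrier_closed)

lemma adjoint_pair_diff:
  "adjoint_pair T S \<Longrightarrow> adjoint_pair T' S' \<Longrightarrow> adjoint_pair (\<lambda>u. T u - T' u) (\<lambda>u. S u - S' u)"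
  by (auto simp: adjoint_pair_def Pi_iff ip_diff_left ip_diff_right carrier_closed)

lemma adjoint_pair_scale:
  "adjoint_pair T S \<Longrightarrow> adjoint_pair (\<lambda>u. scale c (T u)) (\<lambda>u. scale (cnj c) (S u))"
  by (auto simp: adjoint_pair_def Pi_iff ip_scale_left ip_scale_right carrier_closed)

lemma adjoint_pair_comp:
  "adjoint_pair T S \<Longrightarrow> adjoint_pair T' S' \<Longrightarrow> adjoint_pair (\<lambda>u. T (T' u)) (\<lambda>u. S' (S u))"
  by (auto simp: adjoint_pair_def Pi_iff)

lemma adjoint_pair_zero:
  assumes "adjoint_pair T S"
  shows "T 0 = 0"
proof (rule ip_left_eqI)
  show "ip u (T 0) = ip u 0" if "u \<in> X" for u
    using that adjoint_pairD(3)[OF adjoint_pair_sym[OF assms], of u 0]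
    by (simp add: ip_zero_right carrier_closed adjoint_pairD(2)[OF assms])
qed (simp_all add: carrier_closed adjoint_pairD(1)[OF assms])

lemma orth_on_range_eq_ker_on:
  assumes "adjoint_pair T S"
  shows "orth_on ip X (T ` X) = ker_on X S"
proof -
  have "(\<forall>u\<in>X. ip (T u) v = 0) \<longleftrightarrow> S v = 0" if "v \<in> X" for v
    using that ip_left_eqI[of "S v" 0]
    by (auto simp: adjoint_pairD[OF assms] ip_zero_right carrier_closed)
  then show ?thesis
    by (auto simp: orth_on_def ker_on_def)
qed

lemma ker_on_adjoint_comp:
  assumes "adjoint_pair T S"
  shows "ker_on X (\<lambda>u. S (T u)) = ker_on X T"
proof -
  have "T u = 0" if "u \<in> X" "S (T u) = 0" for u
  proof -
    have "ip (T u) (T u) = 0"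
      using that by (simp add: adjoint_pairD[OF assms] ip_zero_right)
    then show ?thesis
      using that by (simp add: adjoint_pairD(1)[OF assms] ip_self_eq_0_iff)
  qed
  then show ?thesis
    using adjoint_pair_zero[OF adjoint_pair_sym[OF assms]] by (auto simp: ker_on_def)
qed

end

section \<open>Operators intertwined by isometric embeddings\<close>

lemma fin_dim_image_iff:
  assumes "Vector_Spaces.linear s1 s2 f" and "inj f"
  shows "fin_dim s2 (f ` S) \<longleftrightarrow> fin_dim s1 S"
proof -
  interpret f: Vector_Spaces.linear s1 s2 f by fact
  have span_iff: "f.vs2.span (f ` B) = f ` S \<longleftrightarrow> f.vs1.span B = S" for B
    using assms(2) by (simp add: f.span_image inj_image_eq_iff)
  show ?thesis
  proof
    assume "fin_dim s2 (f ` S)"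
    then obtain B where "finite B" "B \<subseteq> f ` S" "f.vs2.span B = f ` S"
      by (auto simp: fin_dim_def)
    moreover from this obtain A where "A \<subseteq> S" "finite A" "B = f ` A"
      by (meson finite_subset_image)
    ultimately show "fin_dim s1 S"
      by (auto simp: fin_dim_def span_iff)
  next
    assume "fin_dim s1 S"
    then obtain B where "finite B" "B \<subseteq> S" "f.vs2.span (f ` B) = f ` S"
      by (auto simp: fin_dim_def span_iff)
    then show "fin_dim s2 (f ` S)"
      unfolding fin_dim_def by (metis finite_imageI image_mono)
  qed
qed

lemma cdim_image:
  assumes "Vector_Spaces.linear s1 s2 f" and "inj f"
  shows "cdim s2 (f ` S) = cdim s1 S"
proof -
  interpret f: Vector_Spaces.linear s1 s2 f by fact
  obtain B where B: "B \<subseteq> S" "f.vs1.independent B" "S \<subseteq> f.vs1.span B" "card B = f.vs1.dim S"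
    using f.vs1.basis_exists[of S] by auto
  have "f.vs2.independent (f ` B)"
    using f.independent_injective_image[OF B(2)] assms(2) by (auto intro: inj_on_subset)
  moreover have "f.vs2.span (f ` B) = f.vs2.span (f ` S)"
    using B f.vs1.span_mono[OF B(1)] f.vs1.span_minimal[OF B(3)] by (auto simp: f.span_image)
  moreover have "card (f ` B) = card B"
    using assms(2) by (auto intro: card_image inj_on_subset)
  ultimately show ?thesis
    using f.vs2.dim_eq_card[of "f ` B" "f ` S"] B(4) by (simp add: cdim_def)
qed

text \<open>Linearity and injectivity are required on the whole ambient type, not only on the carrier,
  so that spans and dimensions, which refer to the ambient type, need no relativisation.\<close>

locale isometric_embedding = Vector_Spaces.linear scX scX' J
  for scX :: "complex \<Rightarrow> 'v::ab_group_add \<Rightarrow> 'v"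
    and scX' :: "complex \<Rightarrow> 'w::ab_group_add \<Rightarrow> 'w" and J +
  fixes ipX :: "'v \<Rightarrow> 'v \<Rightarrow> complex" and ipX' :: "'w \<Rightarrow> 'w \<Rightarrow> complex" and X :: "'v set"
  assumes subspace_domain: "vs1.subspace X"
    and inj: "inj J"
    and isometric: "u \<in> X \<Longrightarrow> v \<in> X \<Longrightarrow> ipX' (J u) (J v) = ipX u v"
begin

lemmas domain_closed = vs1.subspace_add[OF subspace_domain] vs1.subspace_diff[OF subspace_domain]
  vs1.subspace_scale[OF subspace_domain]

lemma eq_0_iff: "J u = 0 \<longleftrightarrow> u = 0"
  using inj by (metis injD zero)

lemma ip_norm_image: "u \<in> X \<Longrightarrow> ip_norm ipX' (J u) = ip_norm ipX u"
  by (simp add: ip_norm_def isometric)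

lemma orth_on_image: "S \<subseteq> X \<Longrightarrow> orth_on ipX' (J ` X) (J ` S) = J ` orth_on ipX X S"
  by (fastforce simp: orth_on_def isometric)

lemma norm_closed_in_image_iff:
  assumes "S \<subseteq> X"
  shows "norm_closed_in ipX' (J ` X) (J ` S) \<longleftrightarrow> norm_closed_in ipX X S"
proof -
  have sequences: "(\<forall>s. (\<forall>n. s n \<in> J ` S) \<longrightarrow> P s) \<longleftrightarrow> (\<forall>t. (\<forall>n. t n \<in> S) \<longrightarrow> P (\<lambda>n. J (t n)))"
    for P :: "(nat \<Rightarrow> 'w) \<Rightarrow> bool"
  proof (intro iffI allI impI)
    fix s :: "nat \<Rightarrow> 'w"
    assume P: "\<forall>t. (\<forall>n. t n \<in> S) \<longrightarrow> P (\<lambda>n. J (t n))" and "\<forall>n. s n \<in> J ` S"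
    then obtain t where "\<And>n. t n \<in> S \<and> s n = J (t n)"
      by (metis image_iff)
    then have "\<forall>n. t n \<in> S" "s = (\<lambda>n. J (t n))"
      by auto
    with P show "P s"
      by blast
  qed auto
  have distance: "ip_norm ipX' (J u - J y) = ip_norm ipX (u - y)" if "u \<in> S" "y \<in> X" for u y
    using that assms by (simp add: ip_norm_image domain_closed subset_iff flip: diff)
  have "norm_closed_in ipX' (J ` X) (J ` S) \<longleftrightarrow> (\<forall>s. (\<forall>n. s n \<in> J ` S) \<longrightarrow>
      (\<forall>y\<in>J ` X. (\<lambda>n. ip_norm ipX' (s n - y)) \<longlonglongrightarrow> 0 \<longrightarrow> y \<in> J ` S))"
    unfolding norm_closed_in_def by blast
  also have "\<dots> \<longleftrightarrow> norm_closed_in ipX X S"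
    unfolding sequences norm_closed_in_def by (auto simp: distance inj_image_mem_iff[OF inj])
  finally show ?thesis .
qed

end

locale intertwined_operators =
  J: isometric_embedding scX scX' J ipX ipX' X +
  K: isometric_embedding scY scY' K ipY ipY' Y
  for scX scX' J ipX ipX' X scY scY' K ipY ipY' Y +
  fixes T T'
  assumes intertwine: "u \<in> X \<Longrightarrow> T' (J u) = K (T u)"
begin

lemma ker_on_image: "ker_on (J ` X) T' = J ` ker_on X T"
  by (auto simp: ker_on_def intertwine K.eq_0_iff)

lemma range_image: "T' ` J ` X = K ` T ` X"
  by (auto simp: intertwine image_image)

lemma bounded_linear_on_iff:
  "bounded_linear_on scX' scY' ipX' ipY' (J ` X) (K ` Y) T' \<longleftrightarrow>
    bounded_linear_on scX scY ipX ipY X Y T"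
proof -
  have maps: "(\<forall>u\<in>J ` X. T' u \<in> K ` Y) \<longleftrightarrow> (\<forall>u\<in>X. T u \<in> Y)"
    using K.inj by (auto simp: intertwine inj_image_mem_iff)
  have add: "(\<forall>u\<in>J ` X. \<forall>v\<in>J ` X. T' (u + v) = T' u + T' v)
      \<longleftrightarrow> (\<forall>u\<in>X. \<forall>v\<in>X. T (u + v) = T u + T v)"
    by (simp add: intertwine J.domain_closed inj_eq[OF K.inj] flip: J.add K.add)
  have scale: "(\<forall>c. \<forall>u\<in>J ` X. T' (scX' c u) = scY' c (T' u))
      \<longleftrightarrow> (\<forall>c. \<forall>u\<in>X. T (scX c u) = scY c (T u))"
    by (simp add: intertwine J.domain_closed inj_eq[OF K.inj] flip: J.scale K.scale)
  have bounded: "(\<exists>M. \<forall>u\<in>J ` X. ip_norm ipY' (T' u) \<le> M * ip_norm ipX' u)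
      \<longleftrightarrow> (\<exists>M. \<forall>u\<in>X. ip_norm ipY (T u) \<le> M * ip_norm ipX u)" if "\<forall>u\<in>X. T u \<in> Y"
    using that by (simp add: intertwine J.ip_norm_image K.ip_norm_image)
  show ?thesis
    unfolding bounded_linear_on_def maps add scale using bounded by blast
qed

lemma fredholm_on_iff:
  "fredholm_on scX' scY' ipX' ipY' (J ` X) (K ` Y) T' \<longleftrightarrow> fredholm_on scX scY ipX ipY X Y T"
proof (cases "bounded_linear_on scX scY ipX ipY X Y T")
  case True
  then have "T ` X \<subseteq> Y"
    by (auto simp: bounded_linear_on_def)
  then show ?thesis
    unfolding fredholm_on_def bounded_linear_on_iff ker_on_image range_image
    by (simp add: K.orth_on_image K.norm_closed_in_image_iff
        fin_dim_image_iff[OF J.linear_axioms J.inj] fin_dim_image_iff[OF K.linear_axioms K.inj])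
next
  case False
  then show ?thesis
    by (simp add: fredholm_on_def bounded_linear_on_iff)
qed

end

section \<open>Square-summable sequences\<close>

interpretation sc1: vector_space sc1
  by unfold_locales (auto simp: sc1_def fun_eq_iff algebra_simps)

interpretation sc2: vector_space sc2
  by unfold_locales (auto simp: sc2_def sc1_def fun_eq_iff algebra_simps prod_eq_iff)

definition mult_op :: "seq \<Rightarrow> seq \<Rightarrow> seq" where
  "mult_op d f = (\<lambda>x. d x * f x)"

lemma l2_mult_op:
  assumes "bounded (range d)" "f \<in> l2"
  shows "mult_op d f \<in> l2"
proof -
  obtain B where B: "\<And>x. cmod (d x) \<le> B"
    using assms(1) by (auto simp: bounded_iff)
  have "(\<lambda>x. B\<^sup>2 * (cmod (f x))\<^sup>2) summable_on UNIV"
    using assms(2) by (auto simp: l2_def intro: summable_on_cmult_right)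
  then have "(\<lambda>x. (cmod (d x * f x))\<^sup>2) summable_on UNIV"
  proof (rule summable_on_comparison_test)
    show "(cmod (d x * f x))\<^sup>2 \<le> B\<^sup>2 * (cmod (f x))\<^sup>2" for x
      using power_mono[OF B[of x], of 2] by (simp add: norm_mult power_mult_distrib mult_right_mono)
  qed simp
  then show ?thesis
    by (simp add: l2_def mult_op_def)
qed

lemma l2_sc1: "f \<in> l2 \<Longrightarrow> sc1 c f \<in> l2"
  using l2_mult_op[of "\<lambda>_. c" f] by (simp add: mult_op_def sc1_def)

lemma l2_add:
  assumes "f \<in> l2" "g \<in> l2"
  shows "f + g \<in> l2"
proof -
  have "(\<lambda>x. 2 * (cmod (f x))\<^sup>2 + 2 * (cmod (g x))\<^sup>2) summable_on UNIV"
    using assms by (auto simp: l2_def intro!: summable_on_cmult_right summable_on_add)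
  then have "(\<lambda>x. (cmod (f x + g x))\<^sup>2) summable_on UNIV"
  proof (rule summable_on_comparison_test)
    fix x
    have "(cmod (f x + g x))\<^sup>2 \<le> (cmod (f x) + cmod (g x))\<^sup>2"
      by (simp add: norm_triangle_ineq power_mono)
    also have "\<dots> \<le> 2 * (cmod (f x))\<^sup>2 + 2 * (cmod (g x))\<^sup>2"
      using sum_squares_bound[of "cmod (f x)" "cmod (g x)"] by (simp add: power2_sum)
    finally show "(cmod (f x + g x))\<^sup>2 \<le> 2 * (cmod (f x))\<^sup>2 + 2 * (cmod (g x))\<^sup>2" .
  qed simp
  then show ?thesis
    by (simp add: l2_def)
qed

lemma subspace_l2: "sc1.subspace l2"
  using l2_add l2_sc1 by (auto simp: sc1.subspace_def l2_def)

lemma ip1_summable: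
  assumes "f \<in> l2" "g \<in> l2"
  shows "(\<lambda>x. f x * cnj (g x)) summable_on UNIV"
proof (rule abs_summable_summable)
  have "(\<lambda>x. (cmod (f x))\<^sup>2 + (cmod (g x))\<^sup>2) summable_on UNIV"
    using assms by (auto simp: l2_def intro!: summable_on_add)
  then show "(\<lambda>x. norm (f x * cnj (g x))) summable_on UNIV"
  proof (rule summable_on_comparison_test)
    fix x
    have "2 * (cmod (f x) * cmod (g x)) \<le> (cmod (f x))\<^sup>2 + (cmod (g x))\<^sup>2"
      using sum_squares_bound[of "cmod (f x)" "cmod (g x)"] by simp
    moreover have "0 \<le> cmod (f x) * cmod (g x)"
      by simp
    ultimately show "norm (f x * cnj (g x)) \<le> (cmod (f x))\<^sup>2 + (cmod (g x))\<^sup>2"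
      unfolding norm_mult complex_mod_cnj by linarith
  qed simp
qed

lemma Re_ip1_self:
  assumes "f \<in> l2"
  shows "Re (ip1 f f) = (\<Sum>\<^sub>\<infinity>x. (cmod (f x))\<^sup>2)"
  using infsum_Re[OF ip1_summable[OF assms assms]]
  by (simp add: ip1_def cmod_power2 flip: power2_eq_square)

lemma ip1_pos_def:
  assumes "f \<in> l2" "f \<noteq> 0"
  shows "0 < Re (ip1 f f)"
proof (rule ccontr)
  assume "\<not> 0 < Re (ip1 f f)"
  then have "(\<Sum>\<^sub>\<infinity>x. (cmod (f x))\<^sup>2) \<le> 0"
    by (simp add: Re_ip1_self assms(1))
  then have "(cmod (f x))\<^sup>2 = 0" for x
    using assms(1)
    by (intro nonneg_infsum_le_0D[where A = UNIV and f = "\<lambda>x. (cmod (f x))\<^sup>2"]) (auto simp: l2_def)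
  with assms(2) show False
    by (auto simp: fun_eq_iff)
qed

interpretation l2: inner_product_space sc1 ip1 l2
proof unfold_locales
  show "sc1.subspace l2"
    by (rule subspace_l2)
  show "ip1 g f = cnj (ip1 f g)" for f g
    by (simp add: ip1_def mult.commute flip: infsum_cnj)
  show "ip1 (f + g) h = ip1 f h + ip1 g h" if "f \<in> l2" "g \<in> l2" "h \<in> l2" for f g h
    using that by (simp add: ip1_def distrib_right infsum_add ip1_summable)
  show "ip1 (sc1 c f) g = c * ip1 f g" for c f g
    by (simp add: ip1_def sc1_def mult.assoc infsum_cmult_right')
qed (rule ip1_pos_def)

interpretation H2: inner_product_space sc2 ip2 H2
proof unfold_locales
  show "sc2.subspace H2"
    by (auto simp: sc2.subspace_def H2_def sc2_def l2.carrier_closed zero_prod_def)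
  show "0 < Re (ip2 u u)" if "u \<in> H2" "u \<noteq> 0" for u
    using that l2.ip_pos_def[of "fst u"] l2.ip_pos_def[of "snd u"]
      l2.ip_self_nonneg[of "fst u"] l2.ip_self_nonneg[of "snd u"]
    by (cases "fst u = 0") (auto simp: H2_def ip2_def prod_eq_iff)
  show "ip2 v u = cnj (ip2 u v)" if "u \<in> H2" "v \<in> H2" for u v
    using that l2.ip_commute[of "fst u" "fst v"] l2.ip_commute[of "snd u" "snd v"]
    by (auto simp: H2_def ip2_def)
qed (auto simp: H2_def ip2_def sc2_def l2.ip_add_left l2.ip_scale_left distrib_left)

lemma ip2_eq_infsum:
  assumes "u \<in> H2" "v \<in> H2"
  shows "ip2 u v = (\<Sum>\<^sub>\<infinity>x. fst u x * cnj (fst v x) + snd u x * cnj (snd v x))"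
  using assms by (auto simp: H2_def ip2_def ip1_def infsum_add ip1_summable)

lemma ip2_Pair_zero:
  assumes "f \<in> l2" "g \<in> l2"
  shows "ip2 (f, 0) (g, 0) = ip1 f g" "ip2 (0, f) (0, g) = ip1 f g"
  using assms by (simp_all add: ip2_def l2.ip_zero_left l2.carrier_closed)

lemma l2_shift: "(\<lambda>x. f (x + k)) \<in> l2 \<longleftrightarrow> f \<in> l2"
  unfolding l2_def
  using summable_on_reindex_bij_betw[OF bij_plus_right[of k], where f = "\<lambda>x. (cmod (f x))\<^sup>2"]
  by simp

lemma ip1_shift: "ip1 (\<lambda>x. f (x + k)) (\<lambda>x. g (x + k)) = ip1 f g"
  unfolding ip1_def
  using infsum_reindex_bij_betw[OF bij_plus_right[of k], where f = "\<lambda>x. f x * cnj (g x)"] by simp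

lemma l2_Lsh: "f \<in> l2 \<Longrightarrow> Lsh f \<in> l2" and l2_Lsh_adj: "f \<in> l2 \<Longrightarrow> Lsh_adj f \<in> l2"
  using l2_shift[of f 1] l2_shift[of f "-1"] by (simp_all add: Lsh_def Lsh_adj_def)

lemma adjoint_pair_Lsh: "l2.adjoint_pair Lsh Lsh_adj"
proof -
  have "ip1 (Lsh f) g = ip1 f (Lsh_adj g)" for f g
    using ip1_shift[of f 1 "Lsh_adj g"] by (simp add: Lsh_def Lsh_adj_def)
  then show ?thesis
    by (simp add: l2.adjoint_pair_def l2_Lsh l2_Lsh_adj)
qed

lemma adjoint_pair_mult_op:
  assumes "bounded (range d)"
  shows "l2.adjoint_pair (mult_op d) (mult_op (cnj \<circ> d))"
proof -
  have "bounded (range (cnj \<circ> d))"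
    using assms by (simp add: bounded_iff)
  with assms show ?thesis
    by (auto simp: l2.adjoint_pair_def l2_mult_op) (simp add: ip1_def mult_op_def mult_ac)
qed

section \<open>The diagonalising unitary\<close>

lemma abs_le_1_if_unit_sum_squares:
  fixes x y :: real
  assumes "x\<^sup>2 + y\<^sup>2 = 1"
  shows "\<bar>x\<bar> \<le> 1"
proof -
  have "x\<^sup>2 \<le> 1"
    using assms zero_le_power2[of y] by linarith
  then show ?thesis
    by (simp add: abs_square_le_1)
qed

locale split_step_shift =
  fixes p :: real and q :: complex
  assumes unit_coefficients: "p\<^sup>2 + (cmod q)\<^sup>2 = 1"
begin

text \<open>Half-angle parametrisation: if \<open>p = cos \<alpha>\<close> and \<open>|q| = sin \<alpha>\<close> then \<open>\<kappa> = cos (\<alpha>/2)\<close> and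
  \<open>\<sigma> = sin (\<alpha>/2)\<close>, so that all coefficients become polynomials in \<open>\<kappa>\<close>, \<open>\<sigma>\<close> and the phase.\<close>

definition \<kappa> :: complex where "\<kappa> = complex_of_real (sqrt (1 + p) / sqrt 2)"
definition \<sigma> :: complex where "\<sigma> = complex_of_real (sqrt (1 - p) / sqrt 2)"
definition \<omega> :: complex where "\<omega> = cis (Arg q)"

lemma \<kappa>_square: "1 + complex_of_real p = 2 * (\<kappa> * \<kappa>)"
  and \<sigma>_square: "1 - complex_of_real p = 2 * (\<sigma> * \<sigma>)"
  using abs_le_1_if_unit_sum_squares[OF unit_coefficients]
  by (simp_all add: \<kappa>_def \<sigma>_def flip: of_real_mult)

lemma \<kappa>_\<sigma>_unit: "\<kappa> * \<kappa> + \<sigma> * \<sigma> = 1"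
  using \<kappa>_square \<sigma>_square by algebra

lemma p_half_angle: "complex_of_real p = \<kappa> * \<kappa> - \<sigma> * \<sigma>"
  using \<kappa>_square \<sigma>_square by algebra

lemma cmod_q_half_angle: "complex_of_real (cmod q) = 2 * (\<kappa> * \<sigma>)"
proof -
  have "(cmod q)\<^sup>2 = (1 + p) * (1 - p)"
    using unit_coefficients by (simp add: algebra_simps power2_eq_square)
  then have "cmod q = sqrt (1 + p) * sqrt (1 - p)"
    by (metis norm_ge_zero real_sqrt_mult real_sqrt_unique)
  then show ?thesis
    by (simp add: \<kappa>_def \<sigma>_def flip: of_real_mult)
qed

lemma \<omega>_cnj_\<omega>: "\<omega> * cnj \<omega> = 1"
  by (simp add: \<omega>_def cis_cnj cis_mult)

lemma exp_Arg_eq: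
  "exp (\<i> * complex_of_real (Arg q)) = \<omega>" "exp (- (\<i> * complex_of_real (Arg q))) = cnj \<omega>"
  using cis_cnj[of "Arg q"] by (simp_all add: \<omega>_def cis_conv_exp)

lemma cnj_\<kappa>_\<sigma>: "cnj \<kappa> = \<kappa>" "cnj \<sigma> = \<sigma>"
  by (simp_all add: \<kappa>_def \<sigma>_def)

lemma q_half_angle: "q = 2 * (\<kappa> * \<sigma>) * \<omega>"
  using rcis_cmod_Arg[of q] by (simp add: rcis_def \<omega>_def cmod_q_half_angle)

lemma cnj_q_half_angle: "cnj q = 2 * (\<kappa> * \<sigma>) * cnj \<omega>"
  using arg_cong[OF q_half_angle, of cnj] by (simp add: cnj_\<kappa>_\<sigma>)

lemma eps_eq:
  "eps p q u = ((\<lambda>x. \<kappa> * fst u x - \<sigma> * snd u x),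
                (\<lambda>x. cnj \<omega> * (\<sigma> * fst u (x - 1) + \<kappa> * snd u (x - 1))))"
  by (simp add: eps_def \<kappa>_def \<sigma>_def exp_Arg_eq Lsh_adj_def fun_eq_iff diff_divide_distrib
      add_divide_distrib algebra_simps)

interpretation eps: Vector_Spaces.linear sc2 sc2 "eps p q"
  by unfold_locales (auto simp: eps_eq sc1_def sc2_def prod_eq_iff fun_eq_iff algebra_simps)

definition eps_inv :: "seq2 \<Rightarrow> seq2" where
  "eps_inv v = ((\<lambda>x. \<kappa> * fst v x + \<omega> * (\<sigma> * snd v (x + 1))),
                (\<lambda>x. \<omega> * (\<kappa> * snd v (x + 1)) - \<sigma> * fst v x))"

lemma eps_eps_inv: "eps p q (eps_inv v) = v"
proof -
  have "\<kappa> * (\<kappa> * f + \<omega> * (\<sigma> * g)) - \<sigma> * (\<omega> * (\<kappa> * g) - \<sigma> * f) = f"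
    and "cnj \<omega> * (\<sigma> * (\<kappa> * f + \<omega> * (\<sigma> * g)) + \<kappa> * (\<omega> * (\<kappa> * g) - \<sigma> * f)) = g" for f g
    using \<kappa>_\<sigma>_unit \<omega>_cnj_\<omega> by algebra+
  then show ?thesis
    by (simp add: eps_eq eps_inv_def prod_eq_iff)
qed

lemma eps_inv_eps: "eps_inv (eps p q u) = u"
proof -
  have "\<kappa> * (\<kappa> * f - \<sigma> * g) + \<omega> * (\<sigma> * (cnj \<omega> * (\<sigma> * f + \<kappa> * g))) = f"
    and "\<omega> * (\<kappa> * (cnj \<omega> * (\<sigma> * f + \<kappa> * g))) - \<sigma> * (\<kappa> * f - \<sigma> * g) = g" for f g
    using \<kappa>_\<sigma>_unit \<omega>_cnj_\<omega> by algebra+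
  then show ?thesis
    by (simp add: eps_eq eps_inv_def prod_eq_iff)
qed

lemma inj_eps: "inj (eps p q)"
  by (metis eps_inv_eps injI)

lemma eps_H2:
  assumes "u \<in> H2"
  shows "eps p q u \<in> H2"
proof -
  have "eps p q u = (sc1 \<kappa> (fst u) - sc1 \<sigma> (snd u),
      sc1 (cnj \<omega>) (Lsh_adj (sc1 \<sigma> (fst u) + sc1 \<kappa> (snd u))))"
    by (simp add: eps_eq sc1_def Lsh_adj_def fun_eq_iff)
  with assms show ?thesis
    by (auto simp: H2_def intro!: l2.carrier_closed l2_Lsh_adj)
qed

lemma eps_inv_H2:
  assumes "v \<in> H2"
  shows "eps_inv v \<in> H2"
proof -
  have "eps_inv v = (sc1 \<kappa> (fst v) + sc1 (\<omega> * \<sigma>) (Lsh (snd v)),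
      sc1 (\<omega> * \<kappa>) (Lsh (snd v)) - sc1 \<sigma> (fst v))"
    by (simp add: eps_inv_def sc1_def Lsh_def fun_eq_iff)
  with assms show ?thesis
    by (auto simp: H2_def intro!: l2.carrier_closed l2_Lsh)
qed

lemma bij_betw_eps: "bij_betw (eps p q) H2 H2"
  by (rule bij_betwI[where g = eps_inv]) (auto simp: eps_H2 eps_inv_H2 eps_eps_inv eps_inv_eps)

lemma ip2_eps:
  assumes "u \<in> H2" "v \<in> H2"
  shows "ip2 (eps p q u) (eps p q v) = ip2 u v"
proof -
  define rot where
    "rot w = ((\<lambda>x. \<kappa> * fst w x - \<sigma> * snd w x), (\<lambda>x. cnj \<omega> * (\<sigma> * fst w x + \<kappa> * snd w x)))"
    for w :: seq2
  have snd_eps: "snd (eps p q w) = (\<lambda>x. snd (rot w) (x + (-1)))"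
    and fst_eps: "fst (eps p q w) = fst (rot w)" for w
    by (simp_all add: eps_eq rot_def)
  have rot_H2: "rot w \<in> H2" if "w \<in> H2" for w
    using eps_H2[OF that]
    by (simp add: H2_def mem_Times_iff snd_eps fst_eps l2_shift del: add_uminus_conv_diff)
  have rotation: "(\<kappa> * f - \<sigma> * g) * (\<kappa> * f' - \<sigma> * g')
      + cnj \<omega> * (\<sigma> * f + \<kappa> * g) * (\<omega> * (\<sigma> * f' + \<kappa> * g')) = f * f' + g * g'" for f g f' g'
    using \<kappa>_\<sigma>_unit \<omega>_cnj_\<omega> by algebra
  have pointwise: "fst (rot u) x * cnj (fst (rot v) x) + snd (rot u) x * cnj (snd (rot v) x)
      = fst u x * cnj (fst v x) + snd u x * cnj (snd v x)" for x
    unfolding rot_def fst_conv snd_conv complex_cnj_mult complex_cnj_add complex_cnj_diff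
      complex_cnj_cnj cnj_\<kappa>_\<sigma> by (rule rotation)
  have "ip2 (eps p q u) (eps p q v) = ip2 (rot u) (rot v)"
    by (simp only: ip2_def snd_eps fst_eps ip1_shift)
  also have "\<dots> = ip2 u v"
    using assms by (simp only: ip2_eq_infsum rot_H2 pointwise)
  finally show ?thesis .
qed

lemma eps_unitary: "unitary_on ip2 H2 (eps p q)"
  by (simp add: unitary_on_def bij_betw_eps ip2_eps)

lemma adjoint_on_eps:
  assumes "w \<in> H2"
  shows "adjoint_on ip2 H2 (eps p q) (eps p q w) = w"
  using assms by (intro H2.adjoint_on_eqI) (simp_all add: ip2_eps)

definition grading :: "seq2 \<Rightarrow> seq2" where
  "grading u = (fst u, - snd u)"

lemma Gam_eps: "Gam p q (eps p q u) = eps p q (grading u)"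
proof -
  have "(\<kappa> * \<kappa> - \<sigma> * \<sigma>) * (\<kappa> * f - \<sigma> * g) + 2 * (\<kappa> * \<sigma>) * \<omega> * (cnj \<omega> * (\<sigma> * f + \<kappa> * g))
      = \<kappa> * f + \<sigma> * g"
    and "2 * (\<kappa> * \<sigma>) * cnj \<omega> * (\<kappa> * f - \<sigma> * g) - (\<kappa> * \<kappa> - \<sigma> * \<sigma>) * (cnj \<omega> * (\<sigma> * f + \<kappa> * g))
      = cnj \<omega> * (\<sigma> * f - \<kappa> * g)" for f g
    using \<kappa>_\<sigma>_unit \<omega>_cnj_\<omega> by algebra+
  then show ?thesis
    unfolding Gam_def eps_eq Lsh_def Lsh_adj_def p_half_angle cnj_q_half_angle grading_def
    by (subst q_half_angle) simp
qed

definition eps_plus :: "seq \<Rightarrow> seq2" where "eps_plus f = eps p q (f, 0)"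
definition eps_minus :: "seq \<Rightarrow> seq2" where "eps_minus g = eps p q (0, g)"

sublocale eps_plus: isometric_embedding sc1 sc2 eps_plus ip1 ip2 l2
proof unfold_locales
  show "inj eps_plus"
    using inj_eps by (auto simp: inj_def eps_plus_def)
  show "ip2 (eps_plus f) (eps_plus g) = ip1 f g" if "f \<in> l2" "g \<in> l2" for f g
    using that by (simp add: eps_plus_def ip2_eps H2_def l2.carrier_closed ip2_Pair_zero)
qed (auto simp: eps_plus_def eps_eq sc1_def sc2_def fun_eq_iff algebra_simps subspace_l2)

sublocale eps_minus: isometric_embedding sc1 sc2 eps_minus ip1 ip2 l2
proof unfold_locales
  show "inj eps_minus"
    using inj_eps by (auto simp: inj_def eps_minus_def)
  show "ip2 (eps_minus f) (eps_minus g) = ip1 f g" if "f \<in> l2" "g \<in> l2" for f g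
    using that by (simp add: eps_minus_def ip2_eps H2_def l2.carrier_closed ip2_Pair_zero)
qed (auto simp: eps_minus_def eps_eq sc1_def sc2_def fun_eq_iff algebra_simps subspace_l2)

lemma Collect_H2_eps: "{u \<in> H2. P u} = eps p q ` {w \<in> H2. P (eps p q w)}"
proof -
  have "{u \<in> eps p q ` H2. P u} = eps p q ` {w \<in> H2. P (eps p q w)}"
    by auto
  then show ?thesis
    by (simp only: bij_betw_imp_surj_on[OF bij_betw_eps])
qed

lemma Hplus_eq: "Hplus p q = eps_plus ` l2"
proof -
  have "grading w = w \<longleftrightarrow> snd w = 0" for w
    by (cases w) (simp add: grading_def fun_eq_iff)
  then have "Hplus p q = eps p q ` {w \<in> H2. snd w = 0}"
    using Collect_H2_eps[of "\<lambda>u. Gam p q u = u"] by (simp add: Hplus_def Gam_eps inj_eq[OF inj_eps])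
  also have "{w \<in> H2. snd w = 0} = (\<lambda>f. (f, 0)) ` l2"
    by (auto simp: H2_def l2.carrier_closed)
  finally show ?thesis
    by (simp add: image_image eps_plus_def)
qed

lemma Hminus_eq: "Hminus p q = eps_minus ` l2"
proof -
  have "grading w = - w \<longleftrightarrow> fst w = 0" for w
    by (cases w) (simp add: grading_def fun_eq_iff)
  then have "Hminus p q = eps p q ` {w \<in> H2. fst w = 0}"
    using Collect_H2_eps[of "\<lambda>u. Gam p q u = - u"]
    by (simp add: Hminus_def Gam_eps inj_eq[OF inj_eps] flip: eps.neg)
  also have "{w \<in> H2. fst w = 0} = (\<lambda>g. (0, g)) ` l2"
    by (auto simp: H2_def l2.carrier_closed)
  finally show ?thesis
    by (simp add: image_image eps_minus_def)
qed

text \<open>The diagonal blocks of \<open>\<epsilon>\<^sup>*C\<epsilon>\<close>, with the sign convention of \<^const>\<open>Qeps\<close>.\<close>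

definition Ceps :: "real \<Rightarrow> (int \<Rightarrow> real) \<Rightarrow> (int \<Rightarrow> real) \<Rightarrow> (int \<Rightarrow> complex) \<Rightarrow> seq \<Rightarrow> seq" where
  "Ceps s a1 a2 b f = (\<lambda>x.
     complex_of_real (((1 + s * p) * a1 x + (1 - s * p) * a2 (x + 1)) / 2) * f x
     + complex_of_real (s * cmod q / 2)
       * (\<omega> * b (x + 1) * f (x + 1) + cnj \<omega> * cnj (b x) * f (x - 1)))"

lemma Qeps_eq:
  fixes f :: seq
  shows "Qeps s p q a1 a2 b f x = \<i> / 2 * ((1 + s * p) * \<omega> * (b (x + 1) * f (x + 1))
    - (1 - s * p) * cnj \<omega> * (cnj (b x) * f (x - 1))
    + s * cmod q * (complex_of_real (a2 (x + 1) - a1 x) * f x))"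
proof -
  have "z / (- 2 * \<i>) = \<i> / 2 * z" for z :: complex
    by (simp add: field_simps)
  then show ?thesis
    by (simp only: Qeps_def Lsh_def Lsh_adj_def exp_Arg_eq mult_minus_left mult.assoc
        of_real_mult of_real_add of_real_diff of_real_1)
qed

lemma Qeps_half_angle:
  fixes f :: seq
  shows "\<i> * Qeps 1 p q a1 a2 b f x = \<sigma> * \<sigma> * cnj \<omega> * (cnj (b x) * f (x - 1))
      - \<kappa> * \<kappa> * \<omega> * (b (x + 1) * f (x + 1)) - \<kappa> * \<sigma> * ((complex_of_real (a2 (x + 1)) - a1 x) * f x)"
    and "\<i> * Qeps (-1) p q a1 a2 b f x = \<kappa> * \<kappa> * cnj \<omega> * (cnj (b x) * f (x - 1))
      - \<sigma> * \<sigma> * \<omega> * (b (x + 1) * f (x + 1)) + \<kappa> * \<sigma> * ((complex_of_real (a2 (x + 1)) - a1 x) * f x)"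
  by (simp_all add: Qeps_eq \<kappa>_square \<sigma>_square cmod_q_half_angle mult.assoc)

lemma Ceps_half_angle:
  "Ceps 1 a1 a2 b f x = (\<kappa> * \<kappa> * a1 x + \<sigma> * \<sigma> * a2 (x + 1)) * f x
      + \<kappa> * \<sigma> * (\<omega> * b (x + 1) * f (x + 1) + cnj \<omega> * cnj (b x) * f (x - 1))"
  "Ceps (-1) a1 a2 b f x = (\<sigma> * \<sigma> * a1 x + \<kappa> * \<kappa> * a2 (x + 1)) * f x
      - \<kappa> * \<sigma> * (\<omega> * b (x + 1) * f (x + 1) + cnj \<omega> * cnj (b x) * f (x - 1))"
  by (simp_all add: Ceps_def \<kappa>_square \<sigma>_square cmod_q_half_angle add_divide_distrib)

lemma Coin_eps:
  "Coin a1 a2 b (eps p q (f, g)) = eps p q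
    (Ceps 1 a1 a2 b f + sc1 \<i> (Qeps (-1) p q a1 a2 b g),
     Ceps (-1) a1 a2 b g - sc1 \<i> (Qeps 1 p q a1 a2 b f))"
  (is "_ = eps p q ?blocks")
proof -
  \<comment> \<open>\<open>A\<close>, \<open>A'\<close>, \<open>B\<close>, \<open>B'\<close> stand for \<open>a1 x\<close>, \<open>a2 (x + 1)\<close>, \<open>b (x + 1)\<close>, \<open>cnj (b x)\<close>,
    and \<open>f\<close>, \<open>fm\<close>, \<open>fp\<close> for the values of \<open>f\<close> at \<open>x\<close>, \<open>x - 1\<close>, \<open>x + 1\<close>.\<close>
  have upper: "\<kappa> * (A * (\<kappa> * f - \<sigma> * g) + B' * (cnj \<omega> * (\<sigma> * fm + \<kappa> * gm)))
      + \<omega> * (\<sigma> * (B * (\<kappa> * fp - \<sigma> * gp) + A' * (cnj \<omega> * (\<sigma> * f + \<kappa> * g))))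
    = (\<kappa> * \<kappa> * A + \<sigma> * \<sigma> * A') * f + \<kappa> * \<sigma> * (\<omega> * B * fp + cnj \<omega> * B' * fm)
      + (\<kappa> * \<kappa> * cnj \<omega> * (B' * gm) - \<sigma> * \<sigma> * \<omega> * (B * gp) + \<kappa> * \<sigma> * ((A' - A) * g))"
    for A A' B B' f fm fp g gm gp
    using \<omega>_cnj_\<omega> by algebra
  have lower: "\<omega> * (\<kappa> * (B * (\<kappa> * fp - \<sigma> * gp) + A' * (cnj \<omega> * (\<sigma> * f + \<kappa> * g))))
      - \<sigma> * (A * (\<kappa> * f - \<sigma> * g) + B' * (cnj \<omega> * (\<sigma> * fm + \<kappa> * gm)))
    = (\<sigma> * \<sigma> * A + \<kappa> * \<kappa> * A') * g - \<kappa> * \<sigma> * (\<omega> * B * gp + cnj \<omega> * B' * gm)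
      - (\<sigma> * \<sigma> * cnj \<omega> * (B' * fm) - \<kappa> * \<kappa> * \<omega> * (B * fp) - \<kappa> * \<sigma> * ((A' - A) * f))"
    for A A' B B' f fm fp g gm gp
    using \<omega>_cnj_\<omega> by algebra
  have "eps_inv (Coin a1 a2 b (eps p q (f, g))) = ?blocks"
    unfolding eps_inv_def Coin_def eps_eq sc1_def
    by (intro prod_eqI ext) (simp_all only: fst_conv snd_conv plus_fun_apply minus_apply
        Qeps_half_angle Ceps_half_angle add_diff_cancel_right' upper lower)
  then show ?thesis
    by (metis eps_eps_inv)
qed

lemma Qeps_uminus: "Qeps s p q a1 a2 b (- f) = - Qeps s p q a1 a2 b f"
  by (rule ext) (simp add: Qeps_eq algebra_simps)

lemma Ceps_uminus: "Ceps s a1 a2 b (- f) = - Ceps s a1 a2 b f"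
  by (rule ext, unfold Ceps_def uminus_apply) algebra

lemma Qop_eps:
  "Qop p q a1 a2 b (eps p q (f, g)) = eps p q (Qeps (-1) p q a1 a2 b g, Qeps 1 p q a1 a2 b f)"
  (is "_ = eps p q ?Qfg")
proof -
  have "Gam p q (Coin a1 a2 b (eps p q (f, g))) - Coin a1 a2 b (Gam p q (eps p q (f, g)))
      = eps p q (sc2 (2 * \<i>) ?Qfg)"
    by (simp add: Gam_eps Coin_eps grading_def Qeps_uminus Ceps_uminus flip: eps.diff)
      (simp add: sc2_def sc1_def fun_diff_def fun_Compl_def func_times algebra_simps)
  then show ?thesis
    by (simp add: Qop_def flip: eps.scale)
qed

lemma Qop_eps_plus: "Qop p q a1 a2 b (eps_plus f) = eps_minus (Qeps 1 p q a1 a2 b f)"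
  and Qop_eps_minus: "Qop p q a1 a2 b (eps_minus g) = eps_plus (Qeps (-1) p q a1 a2 b g)"
proof -
  have "Qeps s p q a1 a2 b 0 = 0" for s
    by (simp add: Qeps_def Lsh_def Lsh_adj_def fun_eq_iff)
  then show "Qop p q a1 a2 b (eps_plus f) = eps_minus (Qeps 1 p q a1 a2 b f)"
    "Qop p q a1 a2 b (eps_minus g) = eps_plus (Qeps (-1) p q a1 a2 b g)"
    by (simp_all add: eps_plus_def eps_minus_def Qop_eps)
qed

lemma susy_fredholm_iff:
  "susy_fredholm p q a1 a2 b \<longleftrightarrow> fredholm_on sc1 sc1 ip1 ip1 l2 l2 (Qeps 1 p q a1 a2 b)"
proof -
  interpret intertwined_operators sc1 sc2 eps_plus ip1 ip2 l2 sc1 sc2 eps_minus ip1 ip2 l2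
    "Qeps 1 p q a1 a2 b" "Qop p q a1 a2 b"
    by unfold_locales (rule Qop_eps_plus)
  show ?thesis
    unfolding susy_fredholm_def Hplus_eq Hminus_eq by (rule fredholm_on_iff)
qed

end

section \<open>Walks with a bounded coin\<close>

locale split_step = split_step_shift p q for p q +
  fixes a1 a2 :: "int \<Rightarrow> real" and b :: "int \<Rightarrow> complex"
  assumes bounded_coin: "bounded (range a1)" "bounded (range a2)" "bounded (range b)"
begin

abbreviation Q :: "real \<Rightarrow> seq \<Rightarrow> seq" where "Q s \<equiv> Qeps s p q a1 a2 b"

lemma adjoint_pair_Qeps: "l2.adjoint_pair (Q s) (Q (- s))"
proof -
  define forward where "forward = (\<lambda>f. Lsh (mult_op b f))"
  define backward where "backward = (\<lambda>f. mult_op (cnj \<circ> b) (Lsh_adj f))"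
  define potential where "potential = mult_op (\<lambda>x. complex_of_real (a2 (x + 1) - a1 x))"
  have Q_eq: "Q s = (\<lambda>f. sc1 (\<i> / 2) (sc1 ((1 + s * p) * \<omega>) (forward f)
      - sc1 ((1 - s * p) * cnj \<omega>) (backward f) + sc1 (s * cmod q) (potential f)))" for s
    by (simp add: Qeps_eq forward_def backward_def potential_def mult_op_def Lsh_def
        Lsh_adj_def sc1_def fun_eq_iff mult.assoc)
  have "bounded (range (\<lambda>x. a2 (x + 1)))"
    using bounded_coin(2) by (rule bounded_subset) auto
  then have "bounded (range (\<lambda>x. a2 (x + 1) - a1 x))"
    using bounded_coin(1) by (rule bounded_minus_comp)
  from bounded_linear_image[OF this bounded_linear_of_real]
  have "bounded (range (\<lambda>x. complex_of_real (a2 (x + 1) - a1 x)))"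
    by (simp only: image_image)
  from adjoint_pair_mult_op[OF this]
  have self_adjoint_potential: "l2.adjoint_pair potential potential"
    by (simp add: potential_def o_def)
  have adjoint_forward: "l2.adjoint_pair forward backward"
    unfolding forward_def backward_def
    by (rule l2.adjoint_pair_comp[OF adjoint_pair_Lsh adjoint_pair_mult_op[OF bounded_coin(3)]])
  have "l2.adjoint_pair (Q s) (\<lambda>f. sc1 (cnj (\<i> / 2)) (sc1 (cnj ((1 + s * p) * \<omega>)) (backward f)
      - sc1 (cnj ((1 - s * p) * cnj \<omega>)) (forward f) + sc1 (cnj (s * cmod q)) (potential f)))"
    unfolding Q_eq
    by (intro l2.adjoint_pair_scale l2.adjoint_pair_add l2.adjoint_pair_diff
        adjoint_forward l2.adjoint_pair_sym[OF adjoint_forward] self_adjoint_potential)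
  also have "\<dots> = Q (- s)"
    unfolding Q_eq by (intro ext) (simp add: sc1_def distrib_left right_diff_distrib mult.assoc)
  finally show ?thesis .
qed

lemma adjoint_on_eps_Qop:
  assumes "u \<in> H2"
  shows "adjoint_on ip2 H2 (eps p q) (Qop p q a1 a2 b (eps p q u)) = (Q (-1) (snd u), Q 1 (fst u))"
proof -
  have "(Q (-1) (snd u), Q 1 (fst u)) \<in> H2"
    using assms by (auto simp: H2_def l2.adjoint_pairD(1)[OF adjoint_pair_Qeps])
  then show ?thesis
    using adjoint_on_eps Qop_eps[of a1 a2 b "fst u" "snd u"] by simp
qed

lemma ker_on_Hplus_Hop: "ker_on (Hplus p q) (Hop p q a1 a2 b) = eps_plus ` ker_on l2 (Q 1)"
  and ker_on_Hminus_Hop: "ker_on (Hminus p q) (Hop p q a1 a2 b) = eps_minus ` ker_on l2 (Q (-1))"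
proof -
  interpret plus: intertwined_operators sc1 sc2 eps_plus ip1 ip2 l2 sc1 sc2 eps_plus ip1 ip2 l2
    "\<lambda>f. Q (-1) (Q 1 f)" "Hop p q a1 a2 b"
    by unfold_locales (simp add: Hop_def Qop_eps_plus Qop_eps_minus)
  interpret minus: intertwined_operators sc1 sc2 eps_minus ip1 ip2 l2 sc1 sc2 eps_minus ip1 ip2 l2
    "\<lambda>g. Q 1 (Q (-1) g)" "Hop p q a1 a2 b"
    by unfold_locales (simp add: Hop_def Qop_eps_plus Qop_eps_minus)
  show "ker_on (Hplus p q) (Hop p q a1 a2 b) = eps_plus ` ker_on l2 (Q 1)"
    unfolding Hplus_eq plus.ker_on_image
    by (simp add: l2.ker_on_adjoint_comp[OF adjoint_pair_Qeps[of 1]])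
  show "ker_on (Hminus p q) (Hop p q a1 a2 b) = eps_minus ` ker_on l2 (Q (-1))"
    unfolding Hminus_eq minus.ker_on_image
    using l2.ker_on_adjoint_comp[OF adjoint_pair_Qeps[of "-1"]] by simp
qed

lemma susy_index_eq:
  "susy_index p q a1 a2 b = int (cdim sc1 (ker_on l2 (Q 1))) - int (cdim sc1 (ker_on l2 (Q (-1))))"
  by (simp add: susy_index_def ker_on_Hplus_Hop ker_on_Hminus_Hop
      cdim_image[OF eps_plus.linear_axioms eps_plus.inj]
      cdim_image[OF eps_minus.linear_axioms eps_minus.inj])

lemma fred_index_Qeps:
  "fred_index sc1 sc1 ip1 l2 l2 (Q s)
    = int (cdim sc1 (ker_on l2 (Q s))) - int (cdim sc1 (ker_on l2 (Q (- s))))"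
  by (simp add: fred_index_def l2.orth_on_range_eq_ker_on[OF adjoint_pair_Qeps])

end

lemma bounded_range_if_unit_sum_squares:
  fixes f g :: "'a \<Rightarrow> real"
  assumes "\<And>x. (f x)\<^sup>2 + (g x)\<^sup>2 = 1"
  shows "bounded (range f)"
  using abs_le_1_if_unit_sum_squares[OF assms] by (auto simp: bounded_iff)

lemma split_step_if_susyqw:
  assumes "susyqw p q a1 a2 b"
  shows "split_step p q a1 a2 b"
proof
  have unit: "(a1 x)\<^sup>2 + (cmod (b x))\<^sup>2 = 1" "(a2 x)\<^sup>2 + (cmod (b x))\<^sup>2 = 1" for x
    using assms by (simp_all add: susyqw_def)
  show "bounded (range a1)" "bounded (range a2)"
    using unit bounded_range_if_unit_sum_squares[of _ "\<lambda>x. cmod (b x)"] by blast+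
  have "bounded (range (\<lambda>x. cmod (b x)))"
    using unit bounded_range_if_unit_sum_squares[of "\<lambda>x. cmod (b x)" a1] by (simp add: add.commute)
  then show "bounded (range b)"
    by (simp add: bounded_iff)
  show "p\<^sup>2 + (cmod q)\<^sup>2 = 1"
    using assms by (simp add: susyqw_def)
qed

theorem theorem3p1:
  fixes p :: real and q :: complex and a1 a2 :: "int \<Rightarrow> real" and b :: "int \<Rightarrow> complex"
  assumes "susyqw p q a1 a2 b"
  shows "unitary_on ip2 H2 (eps p q)
    \<and> (\<forall>u\<in>H2. adjoint_on ip2 H2 (eps p q) (Qop p q a1 a2 b (eps p q u))
                 = (Qeps (-1) p q a1 a2 b (snd u), Qeps 1 p q a1 a2 b (fst u)))
    \<and> (susy_fredholm p q a1 a2 b \<longleftrightarrow> fredholm_on sc1 sc1 ip1 ip1 l2 l2 (Qeps 1 p q a1 a2 b))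
    \<and> (susy_fredholm p q a1 a2 b \<longrightarrow>
           susy_index p q a1 a2 b = fred_index sc1 sc1 ip1 l2 l2 (Qeps 1 p q a1 a2 b)
         \<and> fred_index sc1 sc1 ip1 l2 l2 (Qeps 1 p q a1 a2 b)
           = int (cdim sc1 (ker_on l2 (Qeps 1 p q a1 a2 b)))
             - int (cdim sc1 (ker_on l2 (Qeps (-1) p q a1 a2 b))))"
proof -
  interpret split_step p q a1 a2 b
    using assms by (rule split_step_if_susyqw)
  show ?thesis
    using eps_unitary adjoint_on_eps_Qop susy_fredholm_iff susy_index_eq fred_index_Qeps[of 1]
    by simp
qed

end
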